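(* Let $Sys=\{S_1,\dots,S_k\}$ be a finite set of quantum systems, each $S_i$ with a finite-dimensional Hilbert space $\mathcal{H}_{S_i}$. For every $C\subseteq Sys$ let $\mathbb{E}_C=\mathrm{Ef}(\mathcal{H}_C)$. For disjoint $C,D\subseteq Sys$ define $\nabla_{C,D}:\mathbb{E}_C\times\mathbb{E}_D\to\mathbb{E}_{C\cup D}$ by $L_1\boxtimes L_2=\mathrm{Sort}_{C,D}(L_1\otimes_k L_2)$, and let $\eta:2\to\mathbb{E}_\emptyset$ be $0\mapsto 0$, $1\mapsto 1$. Then $(\{\mathbb{E}_C\}_{C\subseteq Sys},\nabla,\eta)$ is a commutative $\mathcal{S}$-graded effect monoid, where $\mathcal{S}$ is the partial commutative monoid of quantum systems.
   Context: A partial commutative monoid (PCM) $\langle M,0,+\rangle$ has a partial binary operation $+$ (write $a\perp b$ when $a+b$ is defined) that is commutative, associative (if $b\perp c$ and $a\perp(b+c)$ then $a\perp b$, $(a+b)\perp c$ and $(a+b)+c=a+(b+c)$), with $0\perp a$ and $0+a=a$. An effect algebra is a PCM $\langle\mathbb{E},0,+\rangle$ with a unary operation $e\mapsto e'$ such that $e'$ is the unique element with $e+e'=1$, where $1=0'$, and $e\perp 1$ implies $e=0$. An effect morphism preserves $0$, defined sums and $'$. Effect algebras form a symmetric monoidal category $\mathbf{EA}$ with unit $2=\{0,1\}$, in which morphisms $\mathbb{E}_A\otimes\mathbb{E}_B\to\mathbb{E}_C$ correspond bijectively to bimorphisms $\mathbb{E}_A\times\mathbb{E}_B\to\mathbb{E}_C$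 (maps that are PCM homomorphisms in each argument separately and send $(1,1)$ to $1$). Given a PCM $M$, an $M$-graded effect monoid consists of: an effect algebra $\mathbb{E}_m$ for each $m\in M$; for each $m\perp n$ an effect morphism $\nabla_{m,n}:\mathbb{E}_m\otimes\mathbb{E}_n\to\mathbb{E}_{m+n}$ (equivalently a bimorphism $\mathbb{E}_m\times\mathbb{E}_n\to\mathbb{E}_{m+n}$); and an effect morphism $\eta:2\to\mathbb{E}_0$, such that $\nabla_{m+n,o}(\nabla_{m,n}(a,b),c)=\nabla_{m,n+o}(a,\nabla_{n,o}(b,c))$ whenever the grades are orthogonal, and $\nabla_{0,m}(\eta(1),a)=a=\nabla_{m,0}(a,\eta(1))$. It is commutative if moreover $\nabla_{m,n}(a,b)=\nabla_{n,m}(b,a)$ for all $m\perp n$. The PCM of quantum systems is $\mathcal{S}=\langle\mathcal{P}(Sys),\emptyset,\uplus\rangle$, where $C\uplus D$ is defined iff $C\cap D=\emptyset$ and then equals $C\cup D$. Set $\mathcal{H}_\emptyset=\mathbb{C}$ and $\mathcal{H}_C=\bigotimes_{S\in C}\mathcal{H}_S$, with the (non-commutative) Kronecker factors ordered by the indices of the systems. For a finite-dimensional Hilbert space $\mathcal{H}$ of dimension $d$, $\mathrm{Ef}(\mathcal{H})=\{L\in\mathbb{C}^{d\times d}: 0\sqsubseteq L\sqsubseteq\mathbb{I}_d\}$ (Löwner order: $A\sqsubseteq B$ iff $B-A$ is positive semidefinite); it is an effect algebra with $L_1+L_2$ the matrix sum, defined iff $L_1+L_2\sqsubseteq\mathbb{I}_d$,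 $0$ the zero matrix, and $L'=\mathbb{I}_d-L$. $\otimes_k$ is the Kronecker product, and $\mathrm{Sort}_{C,D}$ is the map $L\mapsto PLP^\dagger$ where $P$ is the unitary permutation of tensor factors taking $\mathcal{H}_C\otimes\mathcal{H}_D$ to $\mathcal{H}_{C\uplus D}$ (reordering the factors by index). *)

theory Defs
  imports
    "HOL-Algebra.Congruence"
    "Jordan_Normal_Form.Matrix"
    "Jordan_Normal_Form.Conjugate"
    "Jordan_Normal_Form.Schur_Decomposition"
begin

section \<open>Partial commutative monoids and effect algebras\<close>

text \<open>
  A partial operation is a total HOL function \<open>padd\<close> together with its domain of
  definition \<open>orth\<close>; values of \<open>padd\<close> on non-orthogonal pairs, and both fields outside
  the carrier, are irrelevant.
\<close>

record 'a pcm = "'a partial_object" +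
  pzero :: 'a
  orth :: "'a \<Rightarrow> 'a \<Rightarrow> bool"
  padd :: "'a \<Rightarrow> 'a \<Rightarrow> 'a"

record 'a effect_algebra = "'a pcm" +
  compl :: "'a \<Rightarrow> 'a"

locale pcm =
  fixes M :: "('a, 'x) pcm_scheme"
  assumes zero_closed: "pzero M \<in> carrier M"
    and add_closed: "\<lbrakk>a \<in> carrier M; b \<in> carrier M; orth M a b\<rbrakk> \<Longrightarrow> padd M a b \<in> carrier M"
    and orth_sym: "\<lbrakk>a \<in> carrier M; b \<in> carrier M; orth M a b\<rbrakk> \<Longrightarrow> orth M b a"
    and add_commute: "\<lbrakk>a \<in> carrier M; b \<in> carrier M; orth M a b\<rbrakk> \<Longrightarrow> padd M a b = padd M b a"
    and add_assoc: "\<lbrakk>a \<in> carrier M; b \<in> carrier M; c \<in> carrier M;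
        orth M b c; orth M a (padd M b c)\<rbrakk>
      \<Longrightarrow> orth M a b \<and> orth M (padd M a b) c
        \<and> padd M (padd M a b) c = padd M a (padd M b c)"
    and zero_orth: "a \<in> carrier M \<Longrightarrow> orth M (pzero M) a"
    and zero_add: "a \<in> carrier M \<Longrightarrow> padd M (pzero M) a = a"

definition eone :: "('a, 'x) effect_algebra_scheme \<Rightarrow> 'a" where
  "eone E = compl E (pzero E)"

locale effect_algebra = pcm E for E :: "('a, 'x) effect_algebra_scheme" +
  assumes compl_closed: "e \<in> carrier E \<Longrightarrow> compl E e \<in> carrier E"
    and compl_orth: "e \<in> carrier E \<Longrightarrow> orth E e (compl E e)"
    and compl_add: "e \<in> carrier E \<Longrightarrow> padd E e (compl E e) = eone E"
    and compl_unique: "\<lbrakk>e \<in> carrier E; f \<in> carrier E; orth E e f; padd E e f = eone E\<rbrakk>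
      \<Longrightarrow> f = compl E e"
    and orth_one: "\<lbrakk>e \<in> carrier E; orth E e (eone E)\<rbrakk> \<Longrightarrow> e = pzero E"

definition pcm_hom ::
  "('a, 'x) pcm_scheme \<Rightarrow> ('b, 'y) pcm_scheme \<Rightarrow> ('a \<Rightarrow> 'b) \<Rightarrow> bool" where
  "pcm_hom E F h \<longleftrightarrow>
     (\<forall>a\<in>carrier E. h a \<in> carrier F) \<and>
     h (pzero E) = pzero F \<and>
     (\<forall>a\<in>carrier E. \<forall>b\<in>carrier E. orth E a b \<longrightarrow>
        orth F (h a) (h b) \<and> h (padd E a b) = padd F (h a) (h b))"

definition effect_morphism ::
  "('a, 'x) effect_algebra_scheme \<Rightarrow> ('b, 'y) effect_algebra_scheme \<Rightarrow> ('a \<Rightarrow> 'b) \<Rightarrow> bool" where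
  "effect_morphism E F h \<longleftrightarrow>
     pcm_hom E F h \<and> (\<forall>a\<in>carrier E. h (compl E a) = compl F (h a))"

definition effect_bimorphism ::
  "('a, 'x) effect_algebra_scheme \<Rightarrow> ('b, 'y) effect_algebra_scheme \<Rightarrow>
   ('c, 'z) effect_algebra_scheme \<Rightarrow> ('a \<Rightarrow> 'b \<Rightarrow> 'c) \<Rightarrow> bool" where
  "effect_bimorphism E F G h \<longleftrightarrow>
     (\<forall>b\<in>carrier F. pcm_hom E G (\<lambda>a. h a b)) \<and>
     (\<forall>a\<in>carrier E. pcm_hom F G (\<lambda>b. h a b)) \<and>
     h (eone E) (eone F) = eone G"

text \<open>The monoidal unit \<open>2 = {0, 1}\<close>, with \<open>False\<close> as 0 and \<open>True\<close> as 1.\<close>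

definition two_ea :: "bool effect_algebra" where
  "two_ea = \<lparr>carrier = UNIV, pzero = False, orth = (\<lambda>a b. \<not> (a \<and> b)), padd = (\<or>), compl = Not\<rparr>"

section \<open>Graded effect monoids\<close>

text \<open>
  The multiplication is given in its bimorphism form. All the effect algebras of the grading
  have carriers inside one HOL type \<open>'a\<close>; the carriers may differ from grade to grade.
\<close>

locale graded_effect_monoid = pcm M
  for M :: "('m, 'x) pcm_scheme"
  and E :: "'m \<Rightarrow> ('a, 'y) effect_algebra_scheme"
  and nabla :: "'m \<Rightarrow> 'm \<Rightarrow> 'a \<Rightarrow> 'a \<Rightarrow> 'a"
  and eta :: "bool \<Rightarrow> 'a" +
  assumes grade_effect_algebra: "m \<in> carrier M \<Longrightarrow> effect_algebra (E m)"
    and nabla_bimorphism: "\<lbrakk>m \<in> carrier M; n \<in> carrier M; orth M m n\<rbrakk>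
      \<Longrightarrow> effect_bimorphism (E m) (E n) (E (padd M m n)) (nabla m n)"
    and eta_morphism: "effect_morphism two_ea (E (pzero M)) eta"
    and nabla_assoc: "\<lbrakk>m \<in> carrier M; n \<in> carrier M; p \<in> carrier M;
        orth M n p; orth M m (padd M n p);
        a \<in> carrier (E m); b \<in> carrier (E n); c \<in> carrier (E p)\<rbrakk>
      \<Longrightarrow> nabla (padd M m n) p (nabla m n a b) c = nabla m (padd M n p) a (nabla n p b c)"
    and nabla_unit_left: "\<lbrakk>m \<in> carrier M; a \<in> carrier (E m)\<rbrakk>
      \<Longrightarrow> nabla (pzero M) m (eta True) a = a"
    and nabla_unit_right: "\<lbrakk>m \<in> carrier M; a \<in> carrier (E m)\<rbrakk>
      \<Longrightarrow> nabla m (pzero M) a (eta True) = a"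

locale commutative_graded_effect_monoid = graded_effect_monoid +
  assumes nabla_commute: "\<lbrakk>m \<in> carrier M; n \<in> carrier M; orth M m n;
        a \<in> carrier (E m); b \<in> carrier (E n)\<rbrakk>
      \<Longrightarrow> nabla m n a b = nabla n m b a"

section \<open>Effects of a finite-dimensional Hilbert space\<close>

definition pos_semidef :: "nat \<Rightarrow> complex mat \<Rightarrow> bool" where
  "pos_semidef n A \<longleftrightarrow> A \<in> carrier_mat n n \<and> mat_adjoint A = A \<and>
     (\<forall>v \<in> carrier_vec n. 0 \<le> (A *\<^sub>v v) \<bullet>c v)"

definition loewner_le :: "nat \<Rightarrow> complex mat \<Rightarrow> complex mat \<Rightarrow> bool" where
  "loewner_le n A B \<longleftrightarrow> A \<in> carrier_mat n n \<and> B \<in> carrier_mat n n \<and> pos_semidef n (B - A)"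

definition Ef :: "nat \<Rightarrow> complex mat effect_algebra" where
  "Ef n = \<lparr>carrier = {L \<in> carrier_mat n n. loewner_le n (0\<^sub>m n n) L \<and> loewner_le n L (1\<^sub>m n)},
     pzero = 0\<^sub>m n n,
     orth = (\<lambda>L1 L2. loewner_le n (L1 + L2) (1\<^sub>m n)),
     padd = (+),
     compl = (\<lambda>L. 1\<^sub>m n - L)\<rparr>"

section \<open>Quantum systems\<close>

text \<open>
  A quantum system is identified with its index in a linear order, and \<open>d s\<close> is the
  dimension of the Hilbert space of the system \<open>s\<close>.
\<close>

definition quantum_systems_pcm :: "'s set \<Rightarrow> 's set pcm" where
  "quantum_systems_pcm Sys = \<lparr>carrier = Pow Sys, pzero = {},
     orth = (\<lambda>C D. C \<inter> D = {}), padd = (\<union>)\<rparr>"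

definition sys_dim :: "('s \<Rightarrow> nat) \<Rightarrow> 's set \<Rightarrow> nat" where
  "sys_dim d C = (\<Prod>s\<in>C. d s)"

definition sys_effects :: "('s \<Rightarrow> nat) \<Rightarrow> 's set \<Rightarrow> complex mat effect_algebra" where
  "sys_effects d C = Ef (sys_dim d C)"

definition kronecker :: "complex mat \<Rightarrow> complex mat \<Rightarrow> complex mat" (infixl "\<otimes>\<^sub>k" 70) where
  "A \<otimes>\<^sub>k B = mat (dim_row A * dim_row B) (dim_col A * dim_col B)
     (\<lambda>(i, j). A $$ (i div dim_row B, j div dim_col B) * B $$ (i mod dim_row B, j mod dim_col B))"

text \<open>
  \<open>basis_index d [s\<^sub>1, \<dots>, s\<^sub>n] f\<close> is the position of the product basis vector
  \<open>e\<^bsub>f s\<^sub>1\<^esub> \<otimes> \<dots> \<otimes> e\<^bsub>f s\<^sub>n\<^esub>\<close> in the Kronecker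
  product of the spaces of dimensions \<open>d s\<^sub>1, \<dots>, d s\<^sub>n\<close> taken in this order
  (leftmost factor most significant, as in \<open>kronecker\<close>).
\<close>

fun basis_index :: "('s \<Rightarrow> nat) \<Rightarrow> 's list \<Rightarrow> ('s \<Rightarrow> nat) \<Rightarrow> nat" where
  "basis_index d [] f = 0"
| "basis_index d (s # ss) f = f s * (\<Prod>t\<leftarrow>ss. d t) + basis_index d ss f"

text \<open>
  The permutation matrix that sends each product basis vector, with its factors listed as
  those of \<open>C\<close> followed by those of \<open>D\<close>, to the same product with its
  factors in increasing order of index.
\<close>

definition sort_perm :: "('s::linorder \<Rightarrow> nat) \<Rightarrow> 's set \<Rightarrow> 's set \<Rightarrow> complex mat" where
  "sort_perm d C D = mat (sys_dim d (C \<union> D)) (sys_dim d C * sys_dim d D)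
     (\<lambda>(i, j). if \<exists>f. (\<forall>s \<in> C \<union> D. f s < d s) \<and>
                     i = basis_index d (sorted_list_of_set (C \<union> D)) f \<and>
                     j = basis_index d (sorted_list_of_set C @ sorted_list_of_set D) f
                then 1 else 0)"

definition Sort :: "('s::linorder \<Rightarrow> nat) \<Rightarrow> 's set \<Rightarrow> 's set \<Rightarrow> complex mat \<Rightarrow> complex mat" where
  "Sort d C D L = sort_perm d C D * L * mat_adjoint (sort_perm d C D)"

definition sys_nabla ::
  "('s::linorder \<Rightarrow> nat) \<Rightarrow> 's set \<Rightarrow> 's set \<Rightarrow> complex mat \<Rightarrow> complex mat \<Rightarrow> complex mat" where
  "sys_nabla d C D L1 L2 = Sort d C D (L1 \<otimes>\<^sub>k L2)"

definition sys_eta :: "bool \<Rightarrow> complex mat" where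
  "sys_eta b = (if b then 1\<^sub>m 1 else 0\<^sub>m 1 1)"

end

(* Index the product basis of H_C by multi-indices f with f s < d s for s in C. In these
   coordinates the sorting permutation disappears: the entry of A \<boxtimes> B at (f, g) is the entry
   of A at (f|C, g|C) times the entry of B at (f|D, g|D). Associativity, commutativity, the unit
   laws and biadditivity are then identities of numbers. Positivity of A \<boxtimes> B is the Schur
   product theorem, via Gram decompositions obtained by Gaussian elimination. *)

theory Submission
  imports Defs
begin

section \<open>Gram decompositions of positive semidefinite matrices\<close>

text \<open>The identities are formal; the one fact of a different nature is that the product of two
  effects is again an effect. Gram decompositions suit it because they are stable under products of
  entries, and elimination supplies them without eigenvalues or matrix square roots. Kernels on
  arbitrary finite sets replace matrices here so that the induction can delete one index without
  renumbering the others. Additivity and the zero and unit laws are worked out in the left argument;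
  commutativity then carries them to the right one.\<close>

definition quad_form :: "'i set \<Rightarrow> ('i \<Rightarrow> 'i \<Rightarrow> complex) \<Rightarrow> ('i \<Rightarrow> complex) \<Rightarrow> complex" where
  "quad_form S K x = (\<Sum>i\<in>S. \<Sum>j\<in>S. cnj (x i) * K i j * x j)"

text \<open>Taking \<open>Re\<close> loses nothing: Hermitian symmetry makes the form real. Unlike
  the complex order, it leaves plain real inequalities to the elimination.\<close>

definition psd_kernel :: "'i set \<Rightarrow> ('i \<Rightarrow> 'i \<Rightarrow> complex) \<Rightarrow> bool" where
  "psd_kernel S K \<longleftrightarrow> (\<forall>i\<in>S. \<forall>j\<in>S. cnj (K i j) = K j i) \<and> (\<forall>x. 0 \<le> Re (quad_form S K x))"

text \<open>Isolates the dependence on the single coordinate \<open>t\<close> at \<open>a\<close>.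
  By Hermitian symmetry the row and the column of \<open>a\<close> contribute conjugate linear
  terms, so elimination amounts to completing a square in \<open>t\<close>.\<close>

lemma quad_form_insert:
  assumes "finite S" "a \<notin> S" and herm: "\<forall>i\<in>insert a S. \<forall>j\<in>insert a S. cnj (K i j) = K j i"
    and b: "b = (\<Sum>j\<in>S. K a j * x j)"
  shows "quad_form (insert a S) K (x(a := t)) =
    quad_form S K x + cnj t * b + t * cnj b + cnj t * t * K a a"
proof -
  have 1: "(\<Sum>j\<in>S. cnj t * K a j * (x(a := t)) j) = cnj t * b"
    unfolding b sum_distrib_left using assms(2) by (intro sum.cong) auto
  have "(\<Sum>i\<in>S. cnj ((x(a := t)) i) * K i a * t) = (\<Sum>i\<in>S. t * cnj (K a i * x i))"
    using assms(2) herm by (intro sum.cong) auto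
  then have 2: "(\<Sum>i\<in>S. cnj ((x(a := t)) i) * K i a * t) = t * cnj b"
    unfolding b cnj_sum sum_distrib_left .
  have 3: "(\<Sum>i\<in>S. \<Sum>j\<in>S. cnj ((x(a := t)) i) * K i j * (x(a := t)) j) = quad_form S K x"
    unfolding quad_form_def using assms(2) by (intro sum.cong) auto
  have "quad_form (insert a S) K (x(a := t)) =
      cnj t * K a a * t + (\<Sum>j\<in>S. cnj t * K a j * (x(a := t)) j)
      + ((\<Sum>i\<in>S. cnj ((x(a := t)) i) * K i a * t)
         + (\<Sum>i\<in>S. \<Sum>j\<in>S. cnj ((x(a := t)) i) * K i j * (x(a := t)) j))"
    unfolding quad_form_def using assms(1,2) by (simp add: sum.distrib)
  then show ?thesis unfolding 1 2 3 by (simp add: algebra_simps)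
qed

text \<open>Gaussian elimination: subtracting the rank-one kernel of the column of \<open>a\<close> leaves the
  Schur complement, whose form is the value of the old form at the optimal coordinate of \<open>a\<close>.\<close>

lemma psd_kernel_gram:
  assumes "finite S" "psd_kernel S K"
  shows "\<exists>u. \<forall>i\<in>S. \<forall>j\<in>S. K i j = (\<Sum>r\<in>S. u r i * cnj (u r j))"
  using assms
proof (induction S arbitrary: K rule: finite_induct)
  case empty
  then show ?case by simp
next
  case (insert a S)
  define k where "k = K a a"
  have herm: "\<forall>i\<in>insert a S. \<forall>j\<in>insert a S. cnj (K i j) = K j i"
    and pos: "\<And>x. 0 \<le> Re (quad_form (insert a S) K x)"
    using insert.prems unfolding psd_kernel_def by auto
  have split: "quad_form (insert a S) K (x(a := t)) =
      quad_form S K x + cnj t * b + t * cnj b + cnj t * t * k"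
    if "b = (\<Sum>j\<in>S. K a j * x j)" for x t b
    using quad_form_insert[OF insert.hyps herm that] unfolding k_def .
  have "cnj k = k" using herm unfolding k_def by (metis insertI1)
  then have kreal: "k = complex_of_real (Re k)" by (metis Reals_cnj_iff of_real_Re)
  have "quad_form S K (\<lambda>_. 0) = 0" by (simp add: quad_form_def)
  then have "quad_form (insert a S) K ((\<lambda>_. 0)(a := 1)) = k"
    using split[of 0 "\<lambda>_. 0" 1] by simp
  then have "0 \<le> Re k" using pos by metis
  \<comment> \<open>A zero pivot forces its row to vanish: otherwise, with \<open>x\<close> the unit
    vector at \<open>i\<close>, the form is affine in \<open>t\<close> and unbounded below along the
    direction \<open>- K a i\<close>.\<close>
  have zero: "K a i = 0" if "k = 0" "i \<in> S" for i
  proof (rule ccontr)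
    assume "K a i \<noteq> 0"
    define x where "x = (\<lambda>j. if j = i then 1 else 0 :: complex)"
    define N where "N = (cmod (K a i))\<^sup>2"
    have N: "N > 0" using \<open>K a i \<noteq> 0\<close> by (simp add: N_def)
    have "(\<Sum>j\<in>S. K a j * x j) = K a i"
      using insert.hyps that unfolding x_def by (simp add: if_distrib cong: if_cong)
    moreover have "quad_form S K x = K i i"
      using insert.hyps that unfolding quad_form_def x_def
      by (simp add: if_distrib[of cnj] if_distrib[of "\<lambda>z. _ * z"] if_distrib[of "\<lambda>z. z * _"]
          cong: if_cong)
    ultimately have e: "quad_form (insert a S) K (x(a := t)) =
        K i i + cnj t * K a i + t * cnj (K a i)" for t
      using split[of "K a i" x t] that by simp
    have "K a i * cnj (K a i) = of_real N" unfolding N_def by (rule complex_norm_square[symmetric])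
    then have "quad_form (insert a S) K (x(a := - of_real s * K a i)) = K i i - of_real (2 * s * N)" for s
      unfolding e by (simp add: algebra_simps)
    then have "0 \<le> Re (K i i) - 2 * s * N" for s
      using pos[of "x(a := - of_real s * K a i)"] by simp
    \<comment> \<open>For this \<open>s\<close> the bound reads \<open>0 \<le> -1\<close>.\<close>
    from this[of "(Re (K i i) + 1) / (2 * N)"] show False using N by simp
  qed
  \<comment> \<open>Since division by zero yields 0, for \<open>k = 0\<close> this is
    \<open>K\<close> itself and the optimal coordinate \<open>- b / k\<close> used below is 0, so
    both cases run through the same computation.\<close>
  define K' where "K' = (\<lambda>i j. K i j - K i a * K a j / k)"
  have "psd_kernel S K'"
    unfolding psd_kernel_def
  proof (intro conjI ballI allI)
    fix i j assume "i \<in> S" "j \<in> S"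
    then have "cnj (K i j) = K j i" "cnj (K a j) = K j a" "cnj (K i a) = K a i"
      using herm by blast+
    then show "cnj (K' i j) = K' j i"
      using \<open>cnj k = k\<close> unfolding K'_def by simp
  next
    fix x
    define b where "b = (\<Sum>j\<in>S. K a j * x j)"
    have cb: "cnj b = (\<Sum>i\<in>S. cnj (x i) * K i a)"
      unfolding b_def cnj_sum using herm by (intro sum.cong) auto
    have "quad_form S K' x = quad_form S K x - (\<Sum>i\<in>S. \<Sum>j\<in>S. (cnj (x i) * K i a) * (K a j * x j) / k)"
      unfolding quad_form_def K'_def sum_subtractf[symmetric]
      by (intro sum.cong refl) (simp add: algebra_simps)
    also have "(\<Sum>i\<in>S. \<Sum>j\<in>S. (cnj (x i) * K i a) * (K a j * x j) / k) = cnj b * b / k"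
      unfolding cb unfolding b_def sum_product sum_divide_distrib ..
    also have "quad_form S K x - cnj b * b / k = quad_form (insert a S) K (x(a := - b / k))"
    proof -
      have eqs: "cnj (- b / k) * b = - (cnj b * b / k)" "- b / k * cnj b = - (cnj b * b / k)"
        "cnj (- b / k) * (- b / k) * k = cnj b * b / k"
        by (simp_all add: \<open>cnj k = k\<close>)
      then show ?thesis unfolding split[OF b_def, of "- b / k"] eqs by simp
    qed
    finally show "0 \<le> Re (quad_form S K' x)" using pos by simp
  qed
  then obtain u where u: "\<forall>i\<in>S. \<forall>j\<in>S. K' i j = (\<Sum>r\<in>S. u r i * cnj (u r j))"
    using insert.IH by blast
  \<comment> \<open>The new vector is the column of \<open>a\<close> scaled by the root of the
    pivot, as in a Cholesky factorization. The old vectors are set to 0 at \<open>a\<close>, so the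
    row and column of \<open>a\<close> come from the new vector alone.\<close>
  define w where "w = (\<lambda>r i. if r = a then K i a / of_real (sqrt (Re k)) else if i = a then 0 else u r i)"
  have sq: "complex_of_real (sqrt (Re k)) * of_real (sqrt (Re k)) = k"
    using \<open>0 \<le> Re k\<close> kreal by (metis of_real_mult real_sqrt_mult_self abs_of_nonneg)
  have "K i j = (\<Sum>r\<in>insert a S. w r i * cnj (w r j))" if ij: "i \<in> insert a S" "j \<in> insert a S" for i j
  proof -
    have h: "cnj (K j a) = K a j" using herm ij by (metis insertI1)
    have wa: "w a i * cnj (w a j) = K i a * K a j / k"
      unfolding w_def using h sq by simp
    have rest: "(\<Sum>r\<in>S. w r i * cnj (w r j)) = (if i = a \<or> j = a then 0 else K' i j)"
    proof (cases "i = a \<or> j = a")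
      case True
      then show ?thesis using insert.hyps by (auto simp: w_def intro!: sum.neutral)
    next
      case False
      then have "K' i j = (\<Sum>r\<in>S. u r i * cnj (u r j))" using u ij by blast
      also have "\<dots> = (\<Sum>r\<in>S. w r i * cnj (w r j))"
        using False insert.hyps by (intro sum.cong) (auto simp: w_def)
      finally show ?thesis using False by simp
    qed
    \<comment> \<open>For \<open>k = 0\<close> the new vector is 0 by the division convention; it
      then reproduces the row of \<open>a\<close> only because that row vanishes.\<close>
    have "K a l = 0" if "k = 0" "l \<in> insert a S" for l
      using zero[of l] that by (auto simp: k_def)
    then have "k = 0 \<Longrightarrow> K a j = 0" "k = 0 \<Longrightarrow> K a i = 0" using ij by blast+
    moreover have "K i a = cnj (K a i)" using herm ij(1) by (metis insertI1)
    ultimately show ?thesis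
      using insert.hyps wa rest by (auto simp: K'_def k_def)
  qed
  then show ?case by blast
qed

section \<open>Passage between matrices and kernels\<close>

lemma mat_adjoint_index:
  assumes "i < dim_col A" "j < dim_row A"
  shows "mat_adjoint A $$ (i, j) = conjugate (A $$ (j, i))"
  using assms by (simp add: mat_adjoint_def mat_of_rows_index)

lemma dim_mat_adjoint [simp]:
  "dim_row (mat_adjoint A) = dim_col A" "dim_col (mat_adjoint A) = dim_row A"
  by (simp_all add: mat_adjoint_def)

lemma mat_adjoint_eq_iff:
  fixes A :: "complex mat"
  assumes "A \<in> carrier_mat n n"
  shows "mat_adjoint A = A \<longleftrightarrow> (\<forall>i<n. \<forall>j<n. cnj (A $$ (i, j)) = A $$ (j, i))"
proof
  assume "mat_adjoint A = A"
  then show "\<forall>i<n. \<forall>j<n. cnj (A $$ (i, j)) = A $$ (j, i)"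
    using assms mat_adjoint_index[of _ A] by (metis carrier_matD conjugate_complex_def)
next
  assume "\<forall>i<n. \<forall>j<n. cnj (A $$ (i, j)) = A $$ (j, i)"
  then show "mat_adjoint A = A"
    using assms by (intro eq_matI) (auto simp: mat_adjoint_index)
qed

lemma inner_mult_vec_eq_quad_form:
  assumes "A \<in> carrier_mat n n" "v \<in> carrier_vec n"
  shows "(A *\<^sub>v v) \<bullet>c v = quad_form {0..<n} (\<lambda>i j. A $$ (i, j)) (\<lambda>i. v $ i)"
  using assms unfolding quad_form_def scalar_prod_def
  by (auto simp: scalar_prod_def sum_distrib_right intro!: sum.cong)

text \<open>In the complex order \<open>0 \<le> z\<close> also asserts that \<open>z\<close> is
  real. Hermitian symmetry provides this: conjugating the form exchanges its two summation indices.
  Vectors and functions on \<open>nat\<close> give the same values because only coordinates below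
  \<open>n\<close> are read.\<close>

lemma pos_semidef_iff_psd_kernel:
  "pos_semidef n A \<longleftrightarrow> A \<in> carrier_mat n n \<and> psd_kernel {0..<n} (\<lambda>i j. A $$ (i, j))"
proof (cases "A \<in> carrier_mat n n")
  case A: True
  let ?Q = "quad_form {0..<n} (\<lambda>i j. A $$ (i, j))"
  have real: "Im (?Q x) = 0" if "\<forall>i<n. \<forall>j<n. cnj (A $$ (i, j)) = A $$ (j, i)" for x
  proof -
    have "cnj (?Q x) = (\<Sum>i\<in>{0..<n}. \<Sum>j\<in>{0..<n}. cnj (x j) * A $$ (j, i) * x i)"
      unfolding quad_form_def cnj_sum using that by (intro sum.cong) auto
    also have "\<dots> = ?Q x" unfolding quad_form_def by (rule sum.swap)
    finally show ?thesis by (metis Reals_cnj_iff complex_is_Real_iff)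
  qed
  have vec: "?Q (\<lambda>i. vec n x $ i) = ?Q x" for x
    unfolding quad_form_def by (intro sum.cong) auto
  have "(\<forall>v\<in>carrier_vec n. 0 \<le> (A *\<^sub>v v) \<bullet>c v) \<longleftrightarrow> (\<forall>x. 0 \<le> Re (?Q x))"
    if "\<forall>i<n. \<forall>j<n. cnj (A $$ (i, j)) = A $$ (j, i)"
  proof
    assume *: "\<forall>v\<in>carrier_vec n. 0 \<le> (A *\<^sub>v v) \<bullet>c v"
    show "\<forall>x. 0 \<le> Re (?Q x)"
    proof
      fix x
      show "0 \<le> Re (?Q x)"
        using *[rule_format, of "vec n x"] inner_mult_vec_eq_quad_form[OF A, of "vec n x"] vec[of x]
        by (simp add: less_eq_complex_def)
    qed
  next
    assume "\<forall>x. 0 \<le> Re (?Q x)"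
    then show "\<forall>v\<in>carrier_vec n. 0 \<le> (A *\<^sub>v v) \<bullet>c v"
      using inner_mult_vec_eq_quad_form[OF A] real[OF that] by (simp add: less_eq_complex_def)
  qed
  then show ?thesis
    using A mat_adjoint_eq_iff[OF A] unfolding pos_semidef_def psd_kernel_def by auto
qed (simp add: pos_semidef_def)

lemma pos_semidef_gram:
  assumes "pos_semidef n A"
  shows "\<exists>u. \<forall>i<n. \<forall>j<n. A $$ (i, j) = (\<Sum>r<n. u r i * cnj (u r j))"
  using psd_kernel_gram[of "{0..<n}" "\<lambda>i j. A $$ (i, j)"] assms
  by (auto simp: pos_semidef_iff_psd_kernel atLeast0LessThan)

text \<open>The form becomes a sum over \<open>r\<close> of squared moduli. The index set
  \<open>R\<close> is left free so that it can be empty for the zero matrix and a set of pairs for a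
  product.\<close>

lemma gram_pos_semidef:
  assumes "A \<in> carrier_mat n n"
    and gram: "\<And>i j. i < n \<Longrightarrow> j < n \<Longrightarrow> A $$ (i, j) = (\<Sum>r\<in>R. u r i * cnj (u r j))"
  shows "pos_semidef n A"
  unfolding pos_semidef_iff_psd_kernel psd_kernel_def
proof (intro conjI ballI allI)
  fix i j assume "i \<in> {0..<n}" "j \<in> {0..<n}"
  then show "cnj (A $$ (i, j)) = A $$ (j, i)" by (simp add: gram mult.commute)
next
  fix x
  define c where "c = (\<lambda>r. \<Sum>i\<in>{0..<n}. cnj (x i) * u r i)"
  have "quad_form {0..<n} (\<lambda>i j. A $$ (i, j)) x =
      (\<Sum>i\<in>{0..<n}. \<Sum>j\<in>{0..<n}. \<Sum>r\<in>R. (cnj (x i) * u r i) * cnj (cnj (x j) * u r j))"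
    unfolding quad_form_def
    by (intro sum.cong refl) (auto simp: gram sum_distrib_left sum_distrib_right mult_ac)
  also have "\<dots> = (\<Sum>r\<in>R. \<Sum>i\<in>{0..<n}. \<Sum>j\<in>{0..<n}. (cnj (x i) * u r i) * cnj (cnj (x j) * u r j))"
    by (simp only: sum.swap[of _ R "{0..<n}"])
  also have "\<dots> = (\<Sum>r\<in>R. c r * cnj (c r))"
    unfolding c_def cnj_sum sum_product ..
  finally have "Re (quad_form {0..<n} (\<lambda>i j. A $$ (i, j)) x) = (\<Sum>r\<in>R. Re (c r * cnj (c r)))"
    by (simp only: Re_sum)
  also have "\<dots> \<ge> 0" by (intro sum_nonneg) simp
  finally show "0 \<le> Re (quad_form {0..<n} (\<lambda>i j. A $$ (i, j)) x)" .
qed (fact assms)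

section \<open>Effects form an effect algebra\<close>

lemma pos_semidef_carrier: "pos_semidef n A \<Longrightarrow> A \<in> carrier_mat n n"
  by (simp add: pos_semidef_def)

lemma pos_semidef_zero: "pos_semidef n (0\<^sub>m n n)"
  by (rule gram_pos_semidef[where R = "{}"]) auto

lemma pos_semidef_one: "pos_semidef n (1\<^sub>m n)"
proof (rule gram_pos_semidef[where R = "{..<n}" and u = "\<lambda>r i. if r = i then 1 else 0"])
  fix i j assume "i < n" "j < n"
  then show "1\<^sub>m n $$ (i, j) =
      (\<Sum>r<n. (if r = i then 1 else 0) * cnj (if r = j then 1 else 0))"
    by (simp add: if_distrib[of "\<lambda>z. z * _"] cong: if_cong)
qed simp

lemma pos_semidef_add:
  assumes "pos_semidef n A" "pos_semidef n B"
  shows "pos_semidef n (A + B)"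
proof -
  have "quad_form {0..<n} (\<lambda>i j. (A + B) $$ (i, j)) x =
      quad_form {0..<n} (\<lambda>i j. A $$ (i, j)) x + quad_form {0..<n} (\<lambda>i j. B $$ (i, j)) x" for x
    using assms[THEN pos_semidef_carrier] unfolding quad_form_def sum.distrib[symmetric]
    by (intro sum.cong) (auto simp: algebra_simps)
  then show ?thesis
    using assms unfolding pos_semidef_iff_psd_kernel psd_kernel_def by auto
qed

text \<open>In a Gram decomposition a vanishing diagonal forces the vectors to vanish.\<close>

lemma pos_semidef_antisym:
  assumes "pos_semidef n A" "pos_semidef n (- A)"
  shows "A = 0\<^sub>m n n"
proof -
  have A: "A \<in> carrier_mat n n" using assms by (simp add: pos_semidef_def)
  obtain u where u: "\<forall>i<n. \<forall>j<n. A $$ (i, j) = (\<Sum>r<n. u r i * cnj (u r j))"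
    using pos_semidef_gram[OF assms(1)] by blast
  obtain w where w: "\<forall>i<n. \<forall>j<n. (- A) $$ (i, j) = (\<Sum>r<n. w r i * cnj (w r j))"
    using pos_semidef_gram[OF assms(2)] by blast
  have "u r i = 0" if "r < n" "i < n" for r i
  proof -
    have sq: "(\<Sum>r<n. v r i * cnj (v r i)) = of_real (\<Sum>r<n. (cmod (v r i))\<^sup>2)" for v :: "nat \<Rightarrow> nat \<Rightarrow> complex"
      unfolding of_real_sum by (intro sum.cong refl complex_norm_square[symmetric])
    \<comment> \<open>The diagonal entry of \<open>A\<close> and its negative are both sums of
      squares, hence both 0.\<close>
    have "of_real (\<Sum>r<n. (cmod (u r i))\<^sup>2) = - complex_of_real (\<Sum>r<n. (cmod (w r i))\<^sup>2)"
    proof -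
      have "A $$ (i, i) = of_real (\<Sum>r<n. (cmod (u r i))\<^sup>2)"
        unfolding sq[symmetric] using u that by blast
      moreover have "(- A) $$ (i, i) = of_real (\<Sum>r<n. (cmod (w r i))\<^sup>2)"
        unfolding sq[symmetric] using w that by blast
      moreover have "A $$ (i, i) = - (- A) $$ (i, i)" using A that by simp
      ultimately show ?thesis by argo
    qed
    then have "(\<Sum>r<n. (cmod (u r i))\<^sup>2) = - (\<Sum>r<n. (cmod (w r i))\<^sup>2)"
      unfolding of_real_minus[symmetric] of_real_eq_iff .
    moreover have "0 \<le> (\<Sum>r<n. (cmod (w r i))\<^sup>2)" "0 \<le> (\<Sum>r<n. (cmod (u r i))\<^sup>2)"
      by (auto intro: sum_nonneg)
    ultimately have "(\<Sum>r<n. (cmod (u r i))\<^sup>2) = 0" by linarith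
    then show ?thesis using that by (simp add: sum_nonneg_eq_0_iff)
  qed
  then show ?thesis using A u by (intro eq_matI) auto
qed

lemma carrier_Ef_iff: "L \<in> carrier (Ef n) \<longleftrightarrow> pos_semidef n L \<and> pos_semidef n (1\<^sub>m n - L)"
proof -
  have "L - 0\<^sub>m n n = L" if "L \<in> carrier_mat n n" using that by (intro eq_matI) auto
  then show ?thesis by (auto simp: Ef_def loewner_le_def pos_semidef_def)
qed

lemma Ef_carrier_mat: "L \<in> carrier (Ef n) \<Longrightarrow> L \<in> carrier_mat n n"
  by (simp add: Ef_def)

lemma Ef_sel [simp]:
  "pzero (Ef n) = 0\<^sub>m n n" "padd (Ef n) = (+)" "compl (Ef n) = (\<lambda>L. 1\<^sub>m n - L)"
  by (simp_all add: Ef_def)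

lemma eone_Ef [simp]: "eone (Ef n) = 1\<^sub>m n"
  unfolding eone_def by (auto intro: eq_matI)

text \<open>The lower bound on \<open>A + B\<close> is automatic, as sums of positive matrices are
  positive. Every question of definedness thus becomes one of membership among the effects.\<close>

lemma orth_Ef_iff:
  assumes "A \<in> carrier (Ef n)" "B \<in> carrier (Ef n)"
  shows "orth (Ef n) A B \<longleftrightarrow> A + B \<in> carrier (Ef n)"
  using assms pos_semidef_add[of n A B] Ef_carrier_mat[of A n] Ef_carrier_mat[of B n]
  by (auto simp: carrier_Ef_iff) (auto simp: Ef_def loewner_le_def)

lemma effect_algebra_Ef: "effect_algebra (Ef n)"
proof unfold_locales
  note carr = Ef_carrier_mat
  have zero: "0\<^sub>m n n \<in> carrier (Ef n)"
  proof -
    have "1\<^sub>m n - 0\<^sub>m n n = (1\<^sub>m n :: complex mat)" by (intro eq_matI) auto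
    then show ?thesis by (simp add: carrier_Ef_iff pos_semidef_zero pos_semidef_one)
  qed
  then show "pzero (Ef n) \<in> carrier (Ef n)" by simp
  fix a assume a: "a \<in> carrier (Ef n)"
  have za: "0\<^sub>m n n + a = a" using carr[OF a] by simp
  show "orth (Ef n) (pzero (Ef n)) a" using orth_Ef_iff[OF zero a] a za by simp
  show "padd (Ef n) (pzero (Ef n)) a = a" using za by simp
  have "1\<^sub>m n - (1\<^sub>m n - a) = a" using carr[OF a] by (intro eq_matI) auto
  then have ca: "1\<^sub>m n - a \<in> carrier (Ef n)" using a by (simp add: carrier_Ef_iff)
  then show "compl (Ef n) a \<in> carrier (Ef n)" by simp
  have one: "1\<^sub>m n \<in> carrier (Ef n)"
  proof -
    have "1\<^sub>m n - 1\<^sub>m n = (0\<^sub>m n n :: complex mat)" by (intro eq_matI) auto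
    then show ?thesis by (metis carrier_Ef_iff pos_semidef_zero pos_semidef_one)
  qed
  have sum: "a + (1\<^sub>m n - a) = 1\<^sub>m n" using carr[OF a] by (intro eq_matI) auto
  show "orth (Ef n) a (compl (Ef n) a)" using orth_Ef_iff[OF a ca] sum one by simp
  show "padd (Ef n) a (compl (Ef n) a) = eone (Ef n)" using sum by simp
  show "a = pzero (Ef n)" if "orth (Ef n) a (eone (Ef n))"
  proof -
    have "pos_semidef n (1\<^sub>m n - (a + 1\<^sub>m n))"
      using that orth_Ef_iff[OF a one] by (simp add: carrier_Ef_iff)
    \<comment> \<open>Orthogonality to 1 leaves no room above: it makes \<open>- a\<close> positive,
      and \<open>a\<close> is positive already.\<close>
    moreover have "1\<^sub>m n - (a + 1\<^sub>m n) = - a" using carr[OF a] by (intro eq_matI) auto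
    ultimately have "pos_semidef n (- a)" by argo
    then show ?thesis using a unfolding carrier_Ef_iff Ef_sel by (intro pos_semidef_antisym) auto
  qed
  fix b assume b: "b \<in> carrier (Ef n)"
  have comm: "a + b = b + a" using carr[OF a] carr[OF b] by (rule comm_add_mat)
  show "b = compl (Ef n) a" if "padd (Ef n) a b = eone (Ef n)"
  proof -
    have e: "a + b = 1\<^sub>m n" using that by simp
    show ?thesis
      unfolding Ef_sel e[symmetric] using carr[OF a] carr[OF b] by (intro eq_matI) auto
  qed
  show "padd (Ef n) a b \<in> carrier (Ef n)" if "orth (Ef n) a b"
    using that orth_Ef_iff[OF a b] by simp
  show "orth (Ef n) b a" if "orth (Ef n) a b"
    using that orth_Ef_iff[OF a b] orth_Ef_iff[OF b a] comm by simp
  show "padd (Ef n) a b = padd (Ef n) b a" using comm by simp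
  fix c assume c: "c \<in> carrier (Ef n)"
  assume "orth (Ef n) b c" and o: "orth (Ef n) a (padd (Ef n) b c)"
  then have bc: "b + c \<in> carrier (Ef n)" using orth_Ef_iff[OF b c] by simp
  then have abc: "a + (b + c) \<in> carrier (Ef n)" using orth_Ef_iff[OF a bc] o by simp
  have assoc: "a + b + c = a + (b + c)" using carr[OF a] carr[OF b] carr[OF c] by (rule assoc_add_mat)
  \<comment> \<open>The substance of partial associativity: \<open>a + b\<close> stays below 1
    because the gap is the gap of the full sum plus the positive \<open>c\<close>.\<close>
  have "1\<^sub>m n - (a + b) = (1\<^sub>m n - (a + (b + c))) + c"
    using carr[OF a] carr[OF b] carr[OF c] by (intro eq_matI) auto
  then have ab: "a + b \<in> carrier (Ef n)"
    using abc a b c by (simp add: carrier_Ef_iff pos_semidef_add)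
  then show "orth (Ef n) a b \<and> orth (Ef n) (padd (Ef n) a b) c \<and>
      padd (Ef n) (padd (Ef n) a b) c = padd (Ef n) a (padd (Ef n) b c)"
    using orth_Ef_iff[OF a b] orth_Ef_iff[OF ab c] abc assoc by simp
qed

section \<open>Multi-indices\<close>

lemma basis_index_cong:
  "(\<And>s. s \<in> set xs \<Longrightarrow> f s = g s) \<Longrightarrow> basis_index d xs f = basis_index d xs g"
  by (induction xs) auto

lemma basis_index_append:
  "basis_index d (xs @ ys) f = basis_index d xs f * (\<Prod>t\<leftarrow>ys. d t) + basis_index d ys f"
  by (induction xs) (auto simp: algebra_simps)

lemma basis_index_less:
  "(\<And>s. s \<in> set xs \<Longrightarrow> f s < d s) \<Longrightarrow> basis_index d xs f < (\<Prod>t\<leftarrow>xs. d t)"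
proof (induction xs)
  case (Cons s ss)
  have "basis_index d (s # ss) f < (f s + 1) * (\<Prod>t\<leftarrow>ss. d t)" using Cons by simp
  also have "\<dots> \<le> d s * (\<Prod>t\<leftarrow>ss. d t)" using Cons.prems[of s] by (intro mult_right_mono) auto
  finally show ?case by simp
qed simp

text \<open>\<open>basis_index\<close> is positional notation with mixed radices. Quotient and
  remainder by the product of the later dimensions separate the leading digit from the rest.\<close>

lemma basis_index_inject:
  "\<lbrakk>\<And>s. s \<in> set xs \<Longrightarrow> f s < d s; \<And>s. s \<in> set xs \<Longrightarrow> g s < d s\<rbrakk> \<Longrightarrow>
    basis_index d xs f = basis_index d xs g \<longleftrightarrow> (\<forall>s\<in>set xs. f s = g s)"
proof (induction xs)
  case (Cons s ss)
  let ?p = "\<Prod>t\<leftarrow>ss. d t"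
  have less: "basis_index d ss f < ?p" "basis_index d ss g < ?p"
    using Cons.prems by (auto intro!: basis_index_less)
  have div_eq: "(x * p + r) div p = x" if "r < p" for x r p :: nat
    using that by simp
  have "f s = g s \<and> basis_index d ss f = basis_index d ss g"
    if e: "f s * ?p + basis_index d ss f = g s * ?p + basis_index d ss g"
    using arg_cong[OF e, of "\<lambda>i. i div ?p"] arg_cong[OF e, of "\<lambda>i. i mod ?p"] less
    unfolding div_eq[OF less(1)] div_eq[OF less(2)] by simp
  then show ?case using Cons by auto
qed simp

text \<open>The digits are read off by repeated division. Distinctness ensures that setting the
  digit of \<open>s\<close> does not overwrite one already chosen for the tail.\<close>

lemma basis_index_surj:
  "\<lbrakk>distinct xs; i < (\<Prod>t\<leftarrow>xs. d t)\<rbrakk> \<Longrightarrow> \<exists>f. (\<forall>s\<in>set xs. f s < d s) \<and> i = basis_index d xs f"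
proof (induction xs arbitrary: i)
  case (Cons s ss)
  let ?p = "\<Prod>t\<leftarrow>ss. d t"
  have i: "i < d s * ?p" using Cons.prems by simp
  then have p: "0 < ?p" by (cases "?p = 0") auto
  then obtain f where f: "\<forall>s\<in>set ss. f s < d s" "i mod ?p = basis_index d ss f"
    using Cons.IH[of "i mod ?p"] Cons.prems by auto
  let ?f = "f(s := i div ?p)"
  have "i div ?p < d s" using i by (rule less_mult_imp_div_less)
  have "basis_index d ss ?f = basis_index d ss f"
    using Cons.prems by (intro basis_index_cong) auto
  then have "basis_index d (s # ss) ?f = i div ?p * ?p + i mod ?p" using f(2) by simp
  then have "i = basis_index d (s # ss) ?f" by (simp only: div_mult_mod_eq)
  moreover have "\<forall>t\<in>set (s # ss). ?f t < d t" using f(1) \<open>i div ?p < d s\<close> by auto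
  ultimately show ?case by blast
qed simp

text \<open>A multi-index is a total function that is read only on \<open>C\<close>. One
  \<open>f\<close> therefore serves \<open>C\<close>, \<open>D\<close> and their union, and
  restricting it requires no operation.\<close>

definition pos :: "('s::linorder \<Rightarrow> nat) \<Rightarrow> 's set \<Rightarrow> ('s \<Rightarrow> nat) \<Rightarrow> nat" where
  "pos d C f = basis_index d (sorted_list_of_set C) f"

lemma prod_list_sorted_list_of_set:
  "finite C \<Longrightarrow> (\<Prod>t\<leftarrow>sorted_list_of_set C. d t) = sys_dim d C"
  unfolding sys_dim_def by (metis distinct_sorted_list_of_set prod.distinct_set_conv_list set_sorted_list_of_set)

lemma pos_cong: "finite C \<Longrightarrow> (\<And>s. s \<in> C \<Longrightarrow> f s = g s) \<Longrightarrow> pos d C f = pos d C g"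
  unfolding pos_def by (rule basis_index_cong) simp

lemma pos_less:
  "finite C \<Longrightarrow> (\<And>s. s \<in> C \<Longrightarrow> f s < d s) \<Longrightarrow> pos d C f < sys_dim d C"
  unfolding pos_def using basis_index_less[of "sorted_list_of_set C" f d]
  by (simp add: prod_list_sorted_list_of_set)

lemma pos_inject:
  "\<lbrakk>finite C; \<And>s. s \<in> C \<Longrightarrow> f s < d s; \<And>s. s \<in> C \<Longrightarrow> g s < d s\<rbrakk> \<Longrightarrow>
    pos d C f = pos d C g \<longleftrightarrow> (\<forall>s\<in>C. f s = g s)"
  unfolding pos_def using basis_index_inject[of "sorted_list_of_set C" f d g] by simp

lemma pos_surj:
  assumes "finite C" "i < sys_dim d C"
  shows "\<exists>f. (\<forall>s\<in>C. f s < d s) \<and> i = pos d C f"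
  using basis_index_surj[of "sorted_list_of_set C" i d] assms
  by (auto simp: prod_list_sorted_list_of_set pos_def)

text \<open>Every row and column number is the position of some multi-index, so the laws of the
  multiplication can be checked in multi-index coordinates.\<close>

lemma sys_mat_eqI:
  assumes "finite C" "A \<in> carrier_mat (sys_dim d C) (sys_dim d C)"
    "B \<in> carrier_mat (sys_dim d C) (sys_dim d C)"
    and eq: "\<And>f g. \<lbrakk>\<And>s. s \<in> C \<Longrightarrow> f s < d s; \<And>s. s \<in> C \<Longrightarrow> g s < d s\<rbrakk> \<Longrightarrow>
      A $$ (pos d C f, pos d C g) = B $$ (pos d C f, pos d C g)"
  shows "A = B"
proof (rule eq_matI)
  fix i j assume "i < dim_row B" "j < dim_col B"
  then have i: "i < sys_dim d C" and j: "j < sys_dim d C" using assms(3) by auto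
  show "A $$ (i, j) = B $$ (i, j)"
  proof -
    obtain f where f: "\<forall>s\<in>C. f s < d s" "i = pos d C f" using pos_surj[OF assms(1) i] by blast
    obtain g where g: "\<forall>s\<in>C. g s < d s" "j = pos d C g" using pos_surj[OF assms(1) j] by blast
    show ?thesis unfolding f(2) g(2) by (rule eq) (use f(1) g(1) in auto)
  qed
qed (use assms in auto)

lemma sys_dim_union:
  "\<lbrakk>finite C; finite D; C \<inter> D = {}\<rbrakk> \<Longrightarrow> sys_dim d (C \<union> D) = sys_dim d C * sys_dim d D"
  unfolding sys_dim_def by (rule prod.union_disjoint)

section \<open>The graded multiplication\<close>

text \<open>Rows \<open>i\<close> and \<open>k\<close> of \<open>P\<close> are the unit vectors at
  \<open>j\<close> and \<open>l\<close>, so conjugation merely copies an entry. For a permutation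
  matrix this avoids any explicit composition of permutations.\<close>

lemma conjugate_by_selection_index:
  fixes P X :: "complex mat"
  assumes P: "P \<in> carrier_mat m n" and X: "X \<in> carrier_mat n n"
    and "i < m" "k < m" "j < n" "l < n"
    and i: "\<And>q. q < n \<Longrightarrow> P $$ (i, q) = (if q = j then 1 else 0)"
    and k: "\<And>q. q < n \<Longrightarrow> P $$ (k, q) = (if q = l then 1 else 0)"
  shows "(P * X * mat_adjoint P) $$ (i, k) = X $$ (j, l)"
proof -
  have "(P * X) $$ (i, q) = X $$ (j, q)" if "q < n" for q
  proof -
    have "(P * X) $$ (i, q) = (\<Sum>r\<in>{0..<n}. (if r = j then 1 else 0) * X $$ (r, q))"
      using assms that by (auto simp: scalar_prod_def intro!: sum.cong)
    then show ?thesis using \<open>j < n\<close> by (simp add: if_distrib[of "\<lambda>z. z * _"] cong: if_cong)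
  qed
  moreover have "(P * X * mat_adjoint P) $$ (i, k) =
      (\<Sum>q\<in>{0..<n}. (P * X) $$ (i, q) * mat_adjoint P $$ (q, k))"
    using assms by (simp add: scalar_prod_def)
  ultimately have "(P * X * mat_adjoint P) $$ (i, k) =
      (\<Sum>q\<in>{0..<n}. X $$ (j, q) * (if q = l then 1 else 0))"
    using assms by (auto simp: mat_adjoint_index intro!: sum.cong)
  then show ?thesis using \<open>l < n\<close> by (simp add: if_distrib[of "\<lambda>z. _ * z"] cong: if_cong)
qed

lemma sys_nabla_carrier:
  "sys_nabla d C D A B \<in> carrier_mat (sys_dim d (C \<union> D)) (sys_dim d (C \<union> D))"
  by (auto simp: sys_nabla_def Sort_def sort_perm_def intro!: carrier_matI)

text \<open>By injectivity of \<open>pos\<close>, a sorted position determines the multi-index on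
  \<open>C \<union> D\<close>, so its row of \<open>sort_perm\<close> has a single 1. Division and
  remainder in the Kronecker product then recover the positions in the two factors.\<close>

lemma sys_nabla_index:
  assumes fin: "finite C" "finite D" and disj: "C \<inter> D = {}"
    and A: "A \<in> carrier_mat (sys_dim d C) (sys_dim d C)"
    and B: "B \<in> carrier_mat (sys_dim d D) (sys_dim d D)"
    and f: "\<And>s. s \<in> C \<union> D \<Longrightarrow> f s < d s" and g: "\<And>s. s \<in> C \<union> D \<Longrightarrow> g s < d s"
  shows "sys_nabla d C D A B $$ (pos d (C \<union> D) f, pos d (C \<union> D) g) =
    A $$ (pos d C f, pos d C g) * B $$ (pos d D f, pos d D g)"
proof -
  define n where "n = sys_dim d C * sys_dim d D"
  \<comment> \<open>The position of a multi-index before sorting, with the factors of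
    \<open>C\<close> preceding those of \<open>D\<close>.\<close>
  define j where "j = (\<lambda>f. pos d C f * sys_dim d D + pos d D f)"
  have dim: "sys_dim d (C \<union> D) = n" using sys_dim_union[OF fin disj] by (simp add: n_def)
  have app: "basis_index d (sorted_list_of_set C @ sorted_list_of_set D) h = j h" for h
    using fin by (simp add: basis_index_append j_def pos_def prod_list_sorted_list_of_set)
  have row: "pos d (C \<union> D) h < n" "j h < n"
      "\<And>q. q < n \<Longrightarrow> sort_perm d C D $$ (pos d (C \<union> D) h, q) = (if q = j h then 1 else 0)"
    if h: "\<And>s. s \<in> C \<union> D \<Longrightarrow> h s < d s" for h
  proof -
    show less: "pos d (C \<union> D) h < n" using pos_less[of "C \<union> D" h d] fin h by (simp add: dim)
    have "pos d C h < sys_dim d C" "pos d D h < sys_dim d D"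
      using pos_less fin h by (metis UnCI)+
    then have "j h < (pos d C h + 1) * sys_dim d D" "pos d C h + 1 \<le> sys_dim d C"
      by (simp_all add: j_def)
    then have "(pos d C h + 1) * sys_dim d D \<le> n" unfolding n_def by (intro mult_le_mono1)
    with \<open>j h < (pos d C h + 1) * sys_dim d D\<close>
    show "j h < n" by (rule less_le_trans)
    fix q assume "q < n"
    have "(\<exists>f. (\<forall>s\<in>C \<union> D. f s < d s) \<and> pos d (C \<union> D) h = pos d (C \<union> D) f \<and> q = j f) \<longleftrightarrow> q = j h"
    proof
      assume "\<exists>f. (\<forall>s\<in>C \<union> D. f s < d s) \<and> pos d (C \<union> D) h = pos d (C \<union> D) f \<and> q = j f"
      then obtain f where f: "\<forall>s\<in>C \<union> D. f s < d s" "pos d (C \<union> D) h = pos d (C \<union> D) f" "q = j f"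
        by blast
      have "\<forall>s\<in>C \<union> D. h s = f s"
        using pos_inject[of "C \<union> D" h d f] f h fin by blast
      then have "pos d C h = pos d C f" "pos d D h = pos d D f" using fin by (auto intro: pos_cong)
      then show "q = j h" using f(3) by (simp add: j_def)
    qed (use h in blast)
    then show "sort_perm d C D $$ (pos d (C \<union> D) h, q) = (if q = j h then 1 else 0)"
      using less \<open>q < n\<close> dim unfolding sort_perm_def by (simp add: app n_def flip: pos_def)
  qed
  have X: "A \<otimes>\<^sub>k B \<in> carrier_mat n n" using A B unfolding kronecker_def n_def by auto
  have P: "sort_perm d C D \<in> carrier_mat n n" unfolding sort_perm_def dim n_def by simp
  have "sys_nabla d C D A B $$ (pos d (C \<union> D) f, pos d (C \<union> D) g) = (A \<otimes>\<^sub>k B) $$ (j f, j g)"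
    unfolding sys_nabla_def Sort_def
    using conjugate_by_selection_index[OF P X row(1)[OF f] row(1)[OF g] row(2)[OF f] row(2)[OF g]
        row(3)[OF f] row(3)[OF g]] by blast
  also have "\<dots> = A $$ (j f div sys_dim d D, j g div sys_dim d D) *
      B $$ (j f mod sys_dim d D, j g mod sys_dim d D)"
    using A B row(2)[OF f] row(2)[OF g] unfolding kronecker_def n_def by auto
  also have "\<dots> = A $$ (pos d C f, pos d C g) * B $$ (pos d D f, pos d D g)"
    using pos_less[OF fin(2), of f d] pos_less[OF fin(2), of g d] f g by (simp add: j_def)
  finally show ?thesis .
qed

text \<open>The Schur product theorem: products of Gram kernels are Gram kernels.\<close>

lemma sys_nabla_pos_semidef:
  assumes fin: "finite C" "finite D" and disj: "C \<inter> D = {}"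
    and A: "pos_semidef (sys_dim d C) A" and B: "pos_semidef (sys_dim d D) B"
  shows "pos_semidef (sys_dim d (C \<union> D)) (sys_nabla d C D A B)"
proof -
  let ?m = "sys_dim d C" and ?n = "sys_dim d D"
  obtain u where u: "\<forall>i<?m. \<forall>j<?m. A $$ (i, j) = (\<Sum>r<?m. u r i * cnj (u r j))"
    using pos_semidef_gram[OF A] by blast
  obtain w where w: "\<forall>i<?n. \<forall>j<?n. B $$ (i, j) = (\<Sum>r<?n. w r i * cnj (w r j))"
    using pos_semidef_gram[OF B] by blast
  have "\<exists>f. (\<forall>s\<in>C \<union> D. f s < d s) \<and> i = pos d (C \<union> D) f" if "i < sys_dim d (C \<union> D)" for i
    using pos_surj[OF _ that] fin by simp
  then obtain h where h: "\<And>i s. i < sys_dim d (C \<union> D) \<Longrightarrow> s \<in> C \<union> D \<Longrightarrow> h i s < d s"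
      "\<And>i. i < sys_dim d (C \<union> D) \<Longrightarrow> pos d (C \<union> D) (h i) = i"
    by metis
  \<comment> \<open>Tensor products of the Gram vectors of the two factors, indexed by pairs;
    \<open>h i\<close> is a chosen multi-index at position \<open>i\<close>.\<close>
  define z where "z = (\<lambda>(r, t) i. u r (pos d C (h i)) * w t (pos d D (h i)))"
  show ?thesis
  proof (rule gram_pos_semidef[OF sys_nabla_carrier, where R = "{..<?m} \<times> {..<?n}" and u = z])
    fix i j assume i: "i < sys_dim d (C \<union> D)" and j: "j < sys_dim d (C \<union> D)"
    have less: "pos d C (h i) < ?m" "pos d C (h j) < ?m" "pos d D (h i) < ?n" "pos d D (h j) < ?n"
      using pos_less fin h(1)[OF i] h(1)[OF j] by (metis UnCI)+
    have "sys_nabla d C D A B $$ (i, j) =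
        A $$ (pos d C (h i), pos d C (h j)) * B $$ (pos d D (h i), pos d D (h j))"
      using sys_nabla_index[OF fin disj A[THEN pos_semidef_carrier] B[THEN pos_semidef_carrier]
          h(1)[OF i] h(1)[OF j]] h(2)[OF i] h(2)[OF j] by simp
    also have "\<dots> = (\<Sum>r<?m. \<Sum>t<?n. z (r, t) i * cnj (z (r, t) j))"
      using u w less by (simp add: sum_product z_def mult_ac)
    finally show "sys_nabla d C D A B $$ (i, j) = (\<Sum>r\<in>{..<?m} \<times> {..<?n}. z r i * cnj (z r j))"
      by (simp add: sum.cartesian_product)
  qed
qed

text \<open>The Kronecker product does not commute, but sorting brings both orders to the same
  basis, where each entry is a product of the same two numbers.\<close>

lemma sys_nabla_commute:
  assumes fin: "finite C" "finite D" and disj: "C \<inter> D = {}"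
    and A: "A \<in> carrier_mat (sys_dim d C) (sys_dim d C)"
    and B: "B \<in> carrier_mat (sys_dim d D) (sys_dim d D)"
  shows "sys_nabla d C D A B = sys_nabla d D C B A"
proof (rule sys_mat_eqI[of "C \<union> D" _ d])
  show "sys_nabla d D C B A \<in> carrier_mat (sys_dim d (C \<union> D)) (sys_dim d (C \<union> D))"
    using sys_nabla_carrier[of d D C] by (simp add: Un_commute)
  fix f g assume "\<And>s. s \<in> C \<union> D \<Longrightarrow> f s < d s" "\<And>s. s \<in> C \<union> D \<Longrightarrow> g s < d s"
  then show "sys_nabla d C D A B $$ (pos d (C \<union> D) f, pos d (C \<union> D) g) =
      sys_nabla d D C B A $$ (pos d (C \<union> D) f, pos d (C \<union> D) g)"
    using sys_nabla_index[OF fin disj A B, of f g]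
      sys_nabla_index[OF fin(2,1) _ B A, of f g] disj by (simp add: Un_commute Int_commute)
qed (use fin sys_nabla_carrier in auto)

section \<open>Additivity, identities, associativity and units\<close>

lemma sys_nabla_add_left:
  assumes fin: "finite C" "finite D" and disj: "C \<inter> D = {}"
    and A: "A \<in> carrier_mat (sys_dim d C) (sys_dim d C)" "A' \<in> carrier_mat (sys_dim d C) (sys_dim d C)"
    and B: "B \<in> carrier_mat (sys_dim d D) (sys_dim d D)"
  shows "sys_nabla d C D (A + A') B = sys_nabla d C D A B + sys_nabla d C D A' B"
proof (rule sys_mat_eqI[of "C \<union> D" _ d])
  fix f g assume fg: "\<And>s. s \<in> C \<union> D \<Longrightarrow> f s < d s" "\<And>s. s \<in> C \<union> D \<Longrightarrow> g s < d s"
  have less: "pos d (C \<union> D) f < sys_dim d (C \<union> D)" "pos d (C \<union> D) g < sys_dim d (C \<union> D)"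
      "pos d C f < sys_dim d C" "pos d C g < sys_dim d C"
    using fin fg by (auto intro!: pos_less)
  show "sys_nabla d C D (A + A') B $$ (pos d (C \<union> D) f, pos d (C \<union> D) g) =
      (sys_nabla d C D A B + sys_nabla d C D A' B) $$ (pos d (C \<union> D) f, pos d (C \<union> D) g)"
    using sys_nabla_index[OF fin disj _ B fg, of "A + A'"] sys_nabla_index[OF fin disj A(1) B fg]
      sys_nabla_index[OF fin disj A(2) B fg] A less carrier_matD[OF sys_nabla_carrier[of d C D A' B]]
    by (simp add: algebra_simps)
qed (use fin in \<open>auto intro!: add_carrier_mat sys_nabla_carrier\<close>)

lemma sys_nabla_zero_left:
  assumes fin: "finite C" "finite D" and disj: "C \<inter> D = {}"
    and B: "B \<in> carrier_mat (sys_dim d D) (sys_dim d D)"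
  shows "sys_nabla d C D (0\<^sub>m (sys_dim d C) (sys_dim d C)) B =
    0\<^sub>m (sys_dim d (C \<union> D)) (sys_dim d (C \<union> D))"
proof (rule sys_mat_eqI[of "C \<union> D" _ d])
  fix f g assume fg: "\<And>s. s \<in> C \<union> D \<Longrightarrow> f s < d s" "\<And>s. s \<in> C \<union> D \<Longrightarrow> g s < d s"
  have less: "pos d (C \<union> D) f < sys_dim d (C \<union> D)" "pos d (C \<union> D) g < sys_dim d (C \<union> D)"
      "pos d C f < sys_dim d C" "pos d C g < sys_dim d C"
    using fin fg by (auto intro!: pos_less)
  then show "sys_nabla d C D (0\<^sub>m (sys_dim d C) (sys_dim d C)) B $$ (pos d (C \<union> D) f, pos d (C \<union> D) g) =
      0\<^sub>m (sys_dim d (C \<union> D)) (sys_dim d (C \<union> D)) $$ (pos d (C \<union> D) f, pos d (C \<union> D) g)"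
    using sys_nabla_index[OF fin disj _ B fg, of "0\<^sub>m (sys_dim d C) (sys_dim d C)"] by simp
qed (use fin sys_nabla_carrier in auto)

lemma sys_nabla_one:
  assumes fin: "finite C" "finite D" and disj: "C \<inter> D = {}"
  shows "sys_nabla d C D (1\<^sub>m (sys_dim d C)) (1\<^sub>m (sys_dim d D)) = 1\<^sub>m (sys_dim d (C \<union> D))"
proof (rule sys_mat_eqI[of "C \<union> D" _ d])
  fix f g assume fg: "\<And>s. s \<in> C \<union> D \<Longrightarrow> f s < d s" "\<And>s. s \<in> C \<union> D \<Longrightarrow> g s < d s"
  have less: "pos d (C \<union> D) f < sys_dim d (C \<union> D)" "pos d (C \<union> D) g < sys_dim d (C \<union> D)"
      "pos d C f < sys_dim d C" "pos d C g < sys_dim d C"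
      "pos d D f < sys_dim d D" "pos d D g < sys_dim d D"
    using fin fg by (auto intro!: pos_less)
  \<comment> \<open>Two multi-indices agree on the union exactly when they agree on both parts, so
    the Kronecker delta of \<open>C \<union> D\<close> factors.\<close>
  have "pos d (C \<union> D) f = pos d (C \<union> D) g \<longleftrightarrow> pos d C f = pos d C g \<and> pos d D f = pos d D g"
  proof -
    have "pos d E f = pos d E g \<longleftrightarrow> (\<forall>s\<in>E. f s = g s)" if "E \<subseteq> C \<union> D" for E
      by (rule pos_inject) (use fin fg that in \<open>auto intro: finite_subset\<close>)
    from this[of "C \<union> D"] this[of C] this[of D] show ?thesis by blast
  qed
  moreover have "1\<^sub>m (sys_dim d (C \<union> D)) $$ (pos d (C \<union> D) f, pos d (C \<union> D) g) =
      (if pos d (C \<union> D) f = pos d (C \<union> D) g then 1 else 0 :: complex)"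
    using less(1,2) by (rule index_one_mat(1))
  moreover have "sys_nabla d C D (1\<^sub>m (sys_dim d C)) (1\<^sub>m (sys_dim d D)) $$
        (pos d (C \<union> D) f, pos d (C \<union> D) g) =
      (if pos d C f = pos d C g then 1 else 0) * (if pos d D f = pos d D g then 1 else 0)"
    unfolding index_one_mat(1)[OF less(3,4), symmetric] index_one_mat(1)[OF less(5,6), symmetric]
    by (rule sys_nabla_index[OF fin disj one_carrier_mat one_carrier_mat]) (use fg in auto)
  ultimately show "sys_nabla d C D (1\<^sub>m (sys_dim d C)) (1\<^sub>m (sys_dim d D)) $$
        (pos d (C \<union> D) f, pos d (C \<union> D) g) =
      1\<^sub>m (sys_dim d (C \<union> D)) $$ (pos d (C \<union> D) f, pos d (C \<union> D) g)"
    by simp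
qed (use fin sys_nabla_carrier in auto)

lemma sys_nabla_assoc:
  assumes fin: "finite C" "finite D" "finite F"
    and disj: "C \<inter> D = {}" "C \<inter> F = {}" "D \<inter> F = {}"
    and A: "A \<in> carrier_mat (sys_dim d C) (sys_dim d C)"
    and B: "B \<in> carrier_mat (sys_dim d D) (sys_dim d D)"
    and L: "L \<in> carrier_mat (sys_dim d F) (sys_dim d F)"
  shows "sys_nabla d (C \<union> D) F (sys_nabla d C D A B) L =
    sys_nabla d C (D \<union> F) A (sys_nabla d D F B L)"
proof (rule sys_mat_eqI[of "C \<union> D \<union> F" _ d])
  show "sys_nabla d C (D \<union> F) A (sys_nabla d D F B L)
      \<in> carrier_mat (sys_dim d (C \<union> D \<union> F)) (sys_dim d (C \<union> D \<union> F))"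
    using sys_nabla_carrier[of d C "D \<union> F"] by (simp add: Un_assoc)
  fix f g assume fg: "\<And>s. s \<in> C \<union> D \<union> F \<Longrightarrow> f s < d s" "\<And>s. s \<in> C \<union> D \<union> F \<Longrightarrow> g s < d s"
  have "sys_nabla d (C \<union> D) F (sys_nabla d C D A B) L $$ (pos d (C \<union> D \<union> F) f, pos d (C \<union> D \<union> F) g) =
      sys_nabla d C D A B $$ (pos d (C \<union> D) f, pos d (C \<union> D) g) * L $$ (pos d F f, pos d F g)"
    by (rule sys_nabla_index[OF _ _ _ sys_nabla_carrier L]) (use fin disj fg in auto)
  moreover have "sys_nabla d C D A B $$ (pos d (C \<union> D) f, pos d (C \<union> D) g) =
      A $$ (pos d C f, pos d C g) * B $$ (pos d D f, pos d D g)"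
    by (rule sys_nabla_index[OF fin(1,2) disj(1) A B]) (use fg in auto)
  moreover have "sys_nabla d C (D \<union> F) A (sys_nabla d D F B L) $$
        (pos d (C \<union> (D \<union> F)) f, pos d (C \<union> (D \<union> F)) g) =
      A $$ (pos d C f, pos d C g) * sys_nabla d D F B L $$ (pos d (D \<union> F) f, pos d (D \<union> F) g)"
    by (rule sys_nabla_index[OF _ _ _ A sys_nabla_carrier]) (use fin disj fg in auto)
  moreover have "sys_nabla d D F B L $$ (pos d (D \<union> F) f, pos d (D \<union> F) g) =
      B $$ (pos d D f, pos d D g) * L $$ (pos d F f, pos d F g)"
    by (rule sys_nabla_index[OF fin(2,3) disj(3) B L]) (use fg in auto)
  ultimately show "sys_nabla d (C \<union> D) F (sys_nabla d C D A B) L $$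
        (pos d (C \<union> D \<union> F) f, pos d (C \<union> D \<union> F) g) =
      sys_nabla d C (D \<union> F) A (sys_nabla d D F B L) $$ (pos d (C \<union> D \<union> F) f, pos d (C \<union> D \<union> F) g)"
    by (simp only: mult.assoc Un_assoc)
qed (use fin in \<open>auto intro: sys_nabla_carrier\<close>)

lemma sys_nabla_unit_left:
  assumes fin: "finite C" and A: "A \<in> carrier_mat (sys_dim d C) (sys_dim d C)"
  shows "sys_nabla d {} C (1\<^sub>m 1) A = A"
proof (rule sys_mat_eqI[OF fin, of _ d])
  fix f g assume fg: "\<And>s. s \<in> C \<Longrightarrow> f s < d s" "\<And>s. s \<in> C \<Longrightarrow> g s < d s"
  have "sys_nabla d {} C (1\<^sub>m 1) A $$ (pos d ({} \<union> C) f, pos d ({} \<union> C) g) =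
      1\<^sub>m 1 $$ (pos d {} f, pos d {} g) * A $$ (pos d C f, pos d C g)"
    by (rule sys_nabla_index[OF finite.emptyI fin _ _ A]) (use fg in \<open>auto simp: sys_dim_def\<close>)
  \<comment> \<open>The empty system has the single position 0, so the left factor is the number
    1.\<close>
  then show "sys_nabla d {} C (1\<^sub>m 1) A $$ (pos d C f, pos d C g) = A $$ (pos d C f, pos d C g)"
    by (simp add: pos_def)
qed (use A sys_nabla_carrier[of d "{}" C] in auto)

text \<open>The upper bound comes from \<open>1 - A \<boxtimes> B = A \<boxtimes> (1 - B) + (1 - A) \<boxtimes> 1\<close>.\<close>

lemma sys_nabla_effect:
  assumes fin: "finite C" "finite D" and disj: "C \<inter> D = {}"
    and A: "A \<in> carrier (sys_effects d C)" and B: "B \<in> carrier (sys_effects d D)"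
  shows "sys_nabla d C D A B \<in> carrier (sys_effects d (C \<union> D))"
proof -
  let ?I = "1\<^sub>m (sys_dim d C)" and ?J = "1\<^sub>m (sys_dim d D)"
  have psd: "pos_semidef (sys_dim d C) A" "pos_semidef (sys_dim d C) (?I - A)"
      "pos_semidef (sys_dim d D) B" "pos_semidef (sys_dim d D) (?J - B)"
    using A B by (auto simp: sys_effects_def carrier_Ef_iff)
  note carr = psd[THEN pos_semidef_carrier]
  have eqs: "?I = A + (?I - A)" "?J = B + (?J - B)" using carr by (auto intro!: eq_matI)
  \<comment> \<open>Additivity in the second argument, obtained by commuting, adding on the left and
    commuting back.\<close>
  have right: "sys_nabla d C D A ?J = sys_nabla d C D A B + sys_nabla d C D A (?J - B)"
    using sys_nabla_add_left[OF fin(2,1) _ carr(3,4,1)] disj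
      sys_nabla_commute[OF fin disj carr(1)] carr eqs(2) by (auto simp: Int_commute)
  have "1\<^sub>m (sys_dim d (C \<union> D)) = sys_nabla d C D (A + (?I - A)) ?J"
    using sys_nabla_one[OF fin disj, of d] eqs(1) by simp
  also have "\<dots> = sys_nabla d C D A ?J + sys_nabla d C D (?I - A) ?J"
    by (rule sys_nabla_add_left[OF fin disj carr(1,2) one_carrier_mat])
  finally have "1\<^sub>m (sys_dim d (C \<union> D)) - sys_nabla d C D A B =
      sys_nabla d C D A (?J - B) + sys_nabla d C D (?I - A) ?J"
    unfolding right
    using sys_nabla_carrier[of d C D A B] sys_nabla_carrier[of d C D A "?J - B"]
      sys_nabla_carrier[of d C D "?I - A" ?J]
    by (auto intro!: eq_matI)
  then show ?thesis
    using psd sys_nabla_pos_semidef[OF fin disj] pos_semidef_add pos_semidef_one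
    by (simp add: sys_effects_def carrier_Ef_iff)
qed

text \<open>Orthogonality of the images holds because their sum is the image of the sum, which is an
  effect by \<open>sys_nabla_effect\<close>.\<close>

lemma sys_nabla_pcm_hom_left:
  assumes fin: "finite C" "finite D" and disj: "C \<inter> D = {}"
    and B: "B \<in> carrier (sys_effects d D)"
  shows "pcm_hom (sys_effects d C) (sys_effects d (C \<union> D)) (\<lambda>A. sys_nabla d C D A B)"
proof -
  have B': "B \<in> carrier_mat (sys_dim d D) (sys_dim d D)"
    using B by (simp add: sys_effects_def Ef_carrier_mat)
  have eff: "sys_nabla d C D A B \<in> carrier (Ef (sys_dim d (C \<union> D)))" if "A \<in> carrier (Ef (sys_dim d C))" for A
    using sys_nabla_effect[OF fin disj _ B] that by (simp add: sys_effects_def)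
  show ?thesis
    unfolding pcm_hom_def sys_effects_def
    using eff sys_nabla_zero_left[OF fin disj B']
    by (auto simp: orth_Ef_iff sys_nabla_add_left[OF fin disj _ _ B', symmetric] Ef_carrier_mat)
qed

lemma sys_nabla_bimorphism:
  assumes fin: "finite C" "finite D" and disj: "C \<inter> D = {}"
  shows "effect_bimorphism (sys_effects d C) (sys_effects d D) (sys_effects d (C \<union> D)) (sys_nabla d C D)"
  unfolding effect_bimorphism_def
proof (intro conjI ballI)
  fix A assume A: "A \<in> carrier (sys_effects d C)"
  have "pcm_hom (sys_effects d D) (sys_effects d (C \<union> D)) (\<lambda>B. sys_nabla d D C B A)"
    using sys_nabla_pcm_hom_left[OF fin(2,1) _ A] disj by (simp add: Un_commute Int_commute)
  moreover have "sys_nabla d D C B A = sys_nabla d C D A B" if "B \<in> carrier (sys_effects d D)" for B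
    using sys_nabla_commute[OF fin disj] A that by (simp add: sys_effects_def Ef_carrier_mat)
  \<comment> \<open>Commutativity is available only for effects, so exchanging the arguments at zero
    and at defined sums requires that these are effects.\<close>
  moreover have "pcm (sys_effects d D)"
    unfolding sys_effects_def using effect_algebra_Ef by (rule effect_algebra.axioms)
  ultimately show "pcm_hom (sys_effects d D) (sys_effects d (C \<union> D)) (sys_nabla d C D A)"
    unfolding pcm_hom_def by (simp add: pcm.zero_closed pcm.add_closed)
qed (use sys_nabla_pcm_hom_left[OF fin disj] sys_nabla_one[OF fin disj] in
    \<open>auto simp: sys_effects_def\<close>)

section \<open>Assembly of the graded effect monoid\<close>

lemma pcm_quantum_systems: "pcm (quantum_systems_pcm Sys)"
  by unfold_locales (auto simp: quantum_systems_pcm_def)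

lemma sys_eta_morphism: "effect_morphism two_ea (sys_effects d {}) sys_eta"
proof -
  interpret effect_algebra "Ef 1" by (rule effect_algebra_Ef)
  have "0\<^sub>m 1 1 \<in> carrier (Ef 1)" using zero_closed by simp
  moreover from compl_closed[OF this] have "1\<^sub>m 1 \<in> carrier (Ef 1)"
    using eone_Ef[of 1] by (simp add: eone_def)
  moreover have "1\<^sub>m 1 - 0\<^sub>m 1 1 = (1\<^sub>m 1 :: complex mat)" "1\<^sub>m 1 - 1\<^sub>m 1 = (0\<^sub>m 1 1 :: complex mat)"
    by (auto intro!: eq_matI)
  ultimately show ?thesis
    by (auto simp: effect_morphism_def pcm_hom_def two_ea_def sys_eta_def sys_effects_def sys_dim_def
        orth_Ef_iff)
qed

theorem mainTheorem1:
  fixes Sys :: "'s::linorder set" and d :: "'s \<Rightarrow> nat"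
  assumes "finite Sys"
  shows "commutative_graded_effect_monoid
    (quantum_systems_pcm Sys) (sys_effects d) (sys_nabla d) sys_eta"
proof -
  have sel: "pzero (quantum_systems_pcm Sys) = {}"
      "orth (quantum_systems_pcm Sys) = (\<lambda>C D. C \<inter> D = {})"
      "padd (quantum_systems_pcm Sys) = (\<union>)"
    by (simp_all add: quantum_systems_pcm_def)
  have fin: "finite C" if "C \<in> carrier (quantum_systems_pcm Sys)" for C
    using that assms by (auto simp: quantum_systems_pcm_def intro: finite_subset)
  have ea: "effect_algebra (sys_effects d C)" for C
    unfolding sys_effects_def by (rule effect_algebra_Ef)
  have mat: "A \<in> carrier_mat (sys_dim d C) (sys_dim d C)" if "A \<in> carrier (sys_effects d C)" for A C
    using that by (simp add: sys_effects_def Ef_carrier_mat)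
  have left: "sys_nabla d {} C (sys_eta True) A = A"
    if "finite C" "A \<in> carrier (sys_effects d C)" for A C
    using sys_nabla_unit_left[OF that(1) mat[OF that(2)]] by (simp add: sys_eta_def)
  have right: "sys_nabla d C {} A (sys_eta True) = A"
    if "finite C" "A \<in> carrier (sys_effects d C)" for A C
    using left[OF that] sys_nabla_commute[OF that(1) finite.emptyI _ mat[OF that(2)], of "sys_eta True"]
    by (simp add: sys_eta_def sys_dim_def)
  show ?thesis
    unfolding commutative_graded_effect_monoid_def commutative_graded_effect_monoid_axioms_def
      graded_effect_monoid_def graded_effect_monoid_axioms_def sel
    using pcm_quantum_systems ea
    by (auto simp: fin mat left right sys_eta_morphism
        intro!: sys_nabla_bimorphism sys_nabla_assoc sys_nabla_commute)
qed

end
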